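(* Let $G=(V,E)$ be a simple undirected graph. The graphical neighbotope $\Gamma_G$ is the polymatroid base polytope for the polymatroid $$f(S)=|S|+|\mathrm{Nb}_G(S)|,$$ where $\mathrm{Nb}_G(S)=\{u\in V\setminus S : uv\in E\text{ for some }v\in S\}$ for $S\subseteq V$. In particular, $\Gamma_G=B_f$.
   Context: For $v\in V$, $\mathrm{Nb}_G(v)$ is the set of nodes adjacent to $v$. A branching on $G$ is a map $\mathcal{B}:V\to V$ such that $\mathcal{B}(v)\in\mathrm{Nb}_G(v)\cup\{v\}$ for all $v$ and for every $v\in V$ there is $k\geq0$ with $\mathcal{B}^k(v)=\mathcal{B}^{k+1}(v)$. Its reduced in-degree sequence is $\bar\delta(\mathcal{B})\in\mathbb{R}^V$ with $\bar\delta(\mathcal{B})_v=|\mathcal{B}^{-1}(v)|-1$. The graphical neighbotope is $\Gamma_G=\operatorname{conv}\{\bar\delta(\mathcal{B}) : \mathcal{B}\text{ a branching of }G\}\subset\mathbb{R}^V$. A set function $f:2^V\to\mathbb{Z}_{\geq0}$ is a polymatroid if $f(\emptyset)=0$, $f(A)\le f(B)$ for $A\subseteq B$, and $f(A\cup B)+f(A\cap B)\leq f(A)+f(B)$ for all $A,B\subseteq V$. With $x(A)=\sum_{v\in A}x_v$, the polymatroid polytope is $P_f=\{x\in\mathbb{R}^V_{\geq0} : x(A)\leq f(A)\text{ for all }A\subseteq V\}$ and the polymatroid base polytope is $B_f=P_f\cap\{x : x(V)=f(V)\}$.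
   Formalization: The literal equality fails for nonempty V (coordinate sums are 0 on the neighbotope and |V| on B_f), so what is proved is that the neighbotope translated by the all-ones vector equals B_f; V is finite and nonempty. *)

theory Defs
  imports "HOL-Analysis.Analysis"
begin

text \<open>
  The node set \<open>V\<close> is the universe of a finite type \<open>'v\<close>, so that \<open>\<real>\<^sup>V\<close> is \<^typ>\<open>real ^ 'v\<close>;
  a simple undirected graph on \<open>V\<close> is given by its set of edges.
\<close>

definition simple_graph :: "'v set set \<Rightarrow> bool" where
  "simple_graph E \<longleftrightarrow> (\<forall>e\<in>E. card e = 2)"

definition Nb :: "'v set set \<Rightarrow> 'v \<Rightarrow> 'v set" where
  "Nb E v = {u. {u, v} \<in> E}"

definition Nb_set :: "'v set set \<Rightarrow> 'v set \<Rightarrow> 'v set" where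
  "Nb_set E S = {u. u \<notin> S \<and> (\<exists>v\<in>S. {u, v} \<in> E)}"

definition branching :: "'v set set \<Rightarrow> ('v \<Rightarrow> 'v) \<Rightarrow> bool" where
  "branching E B \<longleftrightarrow>
     (\<forall>v. B v \<in> Nb E v \<union> {v}) \<and> (\<forall>v. \<exists>k. (B ^^ k) v = (B ^^ (k + 1)) v)"

definition reduced_indegree :: "('v::finite \<Rightarrow> 'v) \<Rightarrow> real ^ 'v" where
  "reduced_indegree B = (\<chi> v. real (card (B -` {v})) - 1)"

definition neighbotope :: "'v::finite set set \<Rightarrow> (real ^ 'v) set" where
  "neighbotope E = convex hull {reduced_indegree B | B. branching E B}"

definition polymatroid :: "('v set \<Rightarrow> nat) \<Rightarrow> bool" where
  "polymatroid f \<longleftrightarrow>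
     f {} = 0 \<and>
     (\<forall>A B. A \<subseteq> B \<longrightarrow> f A \<le> f B) \<and>
     (\<forall>A B. f (A \<union> B) + f (A \<inter> B) \<le> f A + f B)"

definition polymatroid_polytope :: "('v::finite set \<Rightarrow> nat) \<Rightarrow> (real ^ 'v) set" where
  "polymatroid_polytope f =
     {x. (\<forall>v. 0 \<le> x $ v) \<and> (\<forall>A. (\<Sum>v\<in>A. x $ v) \<le> real (f A))}"

definition base_polytope :: "('v::finite set \<Rightarrow> nat) \<Rightarrow> (real ^ 'v) set" where
  "base_polytope f = polymatroid_polytope f \<inter> {x. (\<Sum>v\<in>UNIV. x $ v) = real (f UNIV)}"

definition nbhd_rank :: "'v set set \<Rightarrow> 'v set \<Rightarrow> nat" where
  "nbhd_rank E S = card S + card (Nb_set E S)"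

text \<open>
  Reduced in-degree sequences have coordinate sum \<open>0\<close>, whereas points of the base polytope of
  \<^term>\<open>nbhd_rank E\<close> have coordinate sum \<open>card V\<close>: the \<open>-1\<close> in \<^const>\<open>reduced_indegree\<close>
  shifts the neighbotope by the all-ones vector. The identification of the two polytopes is
  therefore modulo this fixed translation, which turns \<open>card (B -` {v}) - 1\<close> back into the
  in-degree \<open>card (B -` {v})\<close>.
\<close>

definition ones :: "real ^ 'v::finite" where
  "ones = (\<chi> v. 1)"

end

theory Submission
  imports Defs
begin

text \<open>
  The rank of \<open>S\<close> is the cardinality of the closed neighbourhood \<open>N[S]\<close>, so it is a coverage
  function. In-degree vectors of branchings lie in the base polytope because
  \<open>B v \<in> S\<close> forces \<open>v \<in> N[S]\<close>. Conversely, a point of the base polytope outside the convex hull would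
  be separated from it by a linear functional \<open>w\<close>. Let \<open>B\<close> send each node \<open>v\<close> to a \<open>w\<close>-maximal
  node of \<open>N[v]\<close>, choosing \<open>v\<close> itself whenever possible. Then \<open>w\<close> strictly increases along \<open>B\<close>
  off its fixed points, so \<open>B\<close> is a branching; and the preimage of each superlevel set \<open>{w \<ge> t}\<close> is
  all of \<open>N[{w \<ge> t}]\<close>, so by Abel summation the in-degree vector of \<open>B\<close> maximises \<open>w\<close> on the base
  polytope, contradicting the separation.
\<close>

text \<open>Encoded from the side of \<open>v\<close>: exactly the nodes that a branching may send
  into \<open>S\<close>, so preimages of \<open>S\<close> under branchings lie inside by
  definition.\<close>

definition closed_nbhd :: "'v set set \<Rightarrow> 'v set \<Rightarrow> 'v set" where
  "closed_nbhd E S = {v. \<exists>u\<in>S. u \<in> Nb E v \<union> {v}}"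

lemma closed_nbhd_eq: "closed_nbhd E S = S \<union> Nb_set E S"
  by (auto simp: closed_nbhd_def Nb_def Nb_set_def insert_commute)

lemma nbhd_rank_eq_card_closed_nbhd:
  fixes E :: "'v::finite set set"
  shows "nbhd_rank E S = card (closed_nbhd E S)"
proof -
  have "S \<inter> Nb_set E S = {}"
    by (auto simp: Nb_set_def)
  then show ?thesis
    by (simp add: nbhd_rank_def closed_nbhd_eq card_Un_disjoint)
qed

lemma nbhd_rank_UNIV:
  fixes E :: "'v::finite set set"
  shows "nbhd_rank E UNIV = CARD('v)"
  by (simp add: nbhd_rank_eq_card_closed_nbhd closed_nbhd_eq)

lemma polymatroid_nbhd_rank:
  fixes E :: "'v::finite set set"
  shows "polymatroid (nbhd_rank E)"
  unfolding polymatroid_def nbhd_rank_eq_card_closed_nbhd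
proof (intro conjI allI impI)
  show "card (closed_nbhd E {}) = 0"
    by (simp add: closed_nbhd_def)
next
  fix A B :: "'v set"
  assume "A \<subseteq> B"
  then show "card (closed_nbhd E A) \<le> card (closed_nbhd E B)"
    by (intro card_mono) (auto simp: closed_nbhd_def)
next
  fix A B :: "'v set"
  have "closed_nbhd E (A \<union> B) = closed_nbhd E A \<union> closed_nbhd E B"
    by (auto simp: closed_nbhd_def)
  \<comment> \<open>Only an inclusion: a node can be adjacent to different nodes of \<open>A\<close>
    and \<open>B\<close> without meeting \<open>A \<inter> B\<close>.\<close>
  moreover have "card (closed_nbhd E (A \<inter> B)) \<le> card (closed_nbhd E A \<inter> closed_nbhd E B)"
    by (intro card_mono) (auto simp: closed_nbhd_def)
  ultimately show "card (closed_nbhd E (A \<union> B)) + card (closed_nbhd E (A \<inter> B))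
      \<le> card (closed_nbhd E A) + card (closed_nbhd E B)"
    using card_Un_Int[of "closed_nbhd E A" "closed_nbhd E B"] by simp
qed

definition indegree :: "('v::finite \<Rightarrow> 'v) \<Rightarrow> real ^ 'v" where
  "indegree B = (\<chi> v. real (card (B -` {v})))"

lemma neighbotope_translate:
  "(\<lambda>x. x + ones) ` neighbotope E = convex hull {indegree B | B. branching E B}"
proof -
  have "reduced_indegree B + ones = indegree B" for B :: "'a \<Rightarrow> 'a"
    by (simp add: reduced_indegree_def indegree_def ones_def vec_eq_iff)
  then have "(\<lambda>x. ones + x) ` {reduced_indegree B | B. branching E B}
      = {indegree B | B. branching E B}"
    by (simp add: setcompr_eq_image image_image add.commute)
  then show ?thesis
    using convex_hull_translation[of ones "{reduced_indegree B | B. branching E B}"]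
    by (simp add: neighbotope_def add.commute)
qed

lemma sum_indegree: "(\<Sum>v\<in>A. indegree B $ v) = real (card (B -` A))"
proof -
  have "card (B -` A) = (\<Sum>v\<in>A. card (B -` {v}))"
    using card_UN_disjoint[of A "\<lambda>v. B -` {v}"] by (simp add: disjoint_iff flip: vimage_eq_UN)
  then show ?thesis
    by (simp add: indegree_def)
qed

lemma indegree_in_base_polytope:
  assumes "branching E B"
  shows "indegree B \<in> base_polytope (nbhd_rank E)"
proof -
  have "B v \<in> Nb E v \<union> {v}" for v
    using assms by (simp add: branching_def)
  then have "B -` A \<subseteq> closed_nbhd E A" for A
    unfolding closed_nbhd_def by blast
  then have "card (B -` A) \<le> nbhd_rank E A" for A
    by (simp add: nbhd_rank_eq_card_closed_nbhd card_mono)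
  then show ?thesis
    unfolding base_polytope_def polymatroid_polytope_def
    by (auto simp: sum_indegree nbhd_rank_UNIV) (simp add: indegree_def)
qed

lemma convex_base_polytope: "convex (base_polytope f)"
proof -
  have "(\<Sum>v\<in>A. (u *\<^sub>R x + t *\<^sub>R y) $ v) = u * (\<Sum>v\<in>A. x $ v) + t * (\<Sum>v\<in>A. y $ v)"
    for A u t and x y :: "real ^ 'a"
    by (simp add: sum.distrib sum_distrib_left)
  then show ?thesis
    unfolding convex_def base_polytope_def polymatroid_polytope_def
    by (auto simp flip: distrib_right intro!: convex_bound_le)
qed

text \<open>On \<open>S\<close>, \<open>w - m\<close> is a nonnegative combination of indicators of
  superlevel sets, and each of these pairs nonnegatively with \<open>d\<close>. The induction peels
  off the lowest level of \<open>w\<close>.\<close>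

lemma Abel_inequality:
  fixes w d :: "'a \<Rightarrow> real"
  assumes "finite S" and "\<And>t. 0 \<le> (\<Sum>v\<in>{v\<in>S. t \<le> w v}. d v)" and "\<And>v. v \<in> S \<Longrightarrow> m \<le> w v"
  shows "m * (\<Sum>v\<in>S. d v) \<le> (\<Sum>v\<in>S. w v * d v)"
  using assms
proof (induction "card S" arbitrary: S m rule: less_induct)
  case less
  show ?case
  proof (cases "S = {}")
    case False
    define m0 where "m0 = Min (w ` S)"
    define T where "T = {v\<in>S. m0 < w v}"
    have m0_le: "m0 \<le> w v" if "v \<in> S" for v
      using that less.prems(1) by (simp add: m0_def)
    have "m0 \<in> w ` S"
      using False less.prems(1) by (simp add: m0_def)
    then have "m \<le> m0" and "T \<subset> S"
      using less.prems(3) by (auto simp: T_def)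
    \<comment> \<open>Nonempty superlevel sets of \<open>T\<close> are superlevel sets of
      \<open>S\<close>: a threshold at or below \<open>m0\<close> can be raised to the least value
      of \<open>w\<close> on \<open>T\<close>.\<close>
    have superlevel: "0 \<le> (\<Sum>v\<in>{v\<in>T. t \<le> w v}. d v)" for t
    proof (cases "m0 < t")
      case True
      then have "{v\<in>T. t \<le> w v} = {v\<in>S. t \<le> w v}"
        by (auto simp: T_def)
      then show ?thesis
        using less.prems(2)[of t] by simp
    next
      case le: False
      show ?thesis
      proof (cases "T = {}")
        case ne: False
        have fin: "finite T"
          using \<open>T \<subset> S\<close> less.prems(1) by (meson finite_subset psubset_imp_subset)
        have "Min (w ` T) \<in> w ` T"
          using fin ne by simp
        then have "m0 < Min (w ` T)"
          by (auto simp: T_def)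
        moreover have "Min (w ` T) \<le> w v" if "v \<in> T" for v
          using that fin by simp
        ultimately have "{v\<in>T. t \<le> w v} = {v\<in>S. Min (w ` T) \<le> w v}"
          using le by (auto simp: T_def dest: order_less_le_trans)
        then show ?thesis
          using less.prems(2)[of "Min (w ` T)"] by simp
      qed simp
    qed
    have "m0 * (\<Sum>v\<in>T. d v) \<le> (\<Sum>v\<in>T. w v * d v)"
      using \<open>T \<subset> S\<close> less.prems(1) superlevel
      by (intro less.hyps psubset_card_mono) (auto simp: T_def)
    \<comment> \<open>\<open>S - T\<close> is the bottom level, where \<open>w\<close> is constantly
      \<open>m0\<close>.\<close>
    moreover have "(\<Sum>v\<in>S - T. w v * d v) = m0 * (\<Sum>v\<in>S - T. d v)"
      unfolding sum_distrib_left using m0_le by (intro sum.cong) (force simp: T_def)+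
    moreover have "sum g S = sum g (S - T) + sum g T" for g :: "'a \<Rightarrow> real"
      using \<open>T \<subset> S\<close> less.prems(1) by (intro sum.subset_diff) auto
    ultimately have "m0 * (\<Sum>v\<in>S. d v) \<le> (\<Sum>v\<in>S. w v * d v)"
      by (simp add: distrib_left)
    moreover have "{v\<in>S. m0 \<le> w v} = S"
      using m0_le by auto
    then have "0 \<le> (\<Sum>v\<in>S. d v)"
      using less.prems(2)[of m0] by simp
    then have "m * (\<Sum>v\<in>S. d v) \<le> m0 * (\<Sum>v\<in>S. d v)"
      using \<open>m \<le> m0\<close> by (rule mult_right_mono[rotated])
    ultimately show ?thesis
      by simp
  qed simp
qed

text \<open>Each proper move shrinks the finite set of nodes with larger \<open>w\<close>, so the
  orbit must stop.\<close>

lemma eventually_fixed_if_increasing: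
  fixes w :: "'v::finite \<Rightarrow> real"
  assumes "\<And>v. B v \<noteq> v \<Longrightarrow> w v < w (B v)"
  shows "\<exists>k. (B ^^ k) v = (B ^^ (k + 1)) v"
proof (induction "card {u. w v < w u}" arbitrary: v rule: less_induct)
  case less
  show ?case
  proof (cases "B v = v")
    case True
    then show ?thesis
      by (intro exI[of _ 0]) simp
  next
    case False
    then have "{u. w (B v) < w u} \<subset> {u. w v < w u}"
      using assms[of v] by auto
    then have "card {u. w (B v) < w u} < card {u. w v < w u}"
      by (simp add: psubset_card_mono)
    from less[OF this] obtain k where "(B ^^ k) (B v) = (B ^^ (k + 1)) (B v)" ..
    then have "(B ^^ Suc k) v = (B ^^ (Suc k + 1)) v"
      by (simp add: funpow_Suc_right del: funpow.simps)
    then show ?thesis ..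
  qed
qed

lemma greedy_branching:
  fixes w :: "'v::finite \<Rightarrow> real"
  obtains B where "branching E B" and "\<And>u v. u \<in> Nb E v \<union> {v} \<Longrightarrow> w u \<le> w (B v)"
proof -
  have "\<exists>b\<in>Nb E v \<union> {v}. (\<forall>u\<in>Nb E v \<union> {v}. w u \<le> w b) \<and> (b \<noteq> v \<longrightarrow> w v < w b)" for v
  proof -
    have "Max (w ` (Nb E v \<union> {v})) \<in> w ` (Nb E v \<union> {v})"
      by (rule Max_in) auto
    then obtain b where b: "b \<in> Nb E v \<union> {v}" "w b = Max (w ` (Nb E v \<union> {v}))"
      by (metis imageE)
    then have max: "w u \<le> w b" if "u \<in> Nb E v \<union> {v}" for u
      unfolding b(2) using that by (intro Max_ge) auto
    show ?thesis
    proof (cases "w v < w b")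
      case True
      then show ?thesis
        using b(1) max by blast
    next
      \<comment> \<open>Here \<open>v\<close> itself attains the maximum and is chosen. Moving to a
        tied neighbour instead could make two adjacent nodes swap forever.\<close>
      case False
      then show ?thesis
        using max by (intro bexI[of _ v]) force+
    qed
  qed
  then obtain B where B: "\<And>v. B v \<in> Nb E v \<union> {v}" "\<And>v u. u \<in> Nb E v \<union> {v} \<Longrightarrow> w u \<le> w (B v)"
      "\<And>v. B v \<noteq> v \<Longrightarrow> w v < w (B v)"
    by metis
  have "branching E B"
    unfolding branching_def using B(1) eventually_fixed_if_increasing[of B w] B(3) by blast
  then show thesis
    using B(2) that by blast
qed

text \<open>The greedy \<open>B\<close> depends on \<open>w\<close> alone, so one branching bounds
  every \<open>x\<close>.\<close>

lemma base_polytope_linear_bound: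
  fixes E :: "'v::finite set set" and w :: "real ^ 'v"
  obtains B where "branching E B"
    and "\<And>x. x \<in> base_polytope (nbhd_rank E) \<Longrightarrow> w \<bullet> x \<le> w \<bullet> indegree B"
proof -
  obtain B where B: "branching E B" and greedy: "\<And>u v. u \<in> Nb E v \<union> {v} \<Longrightarrow> w $ u \<le> w $ B v"
    using greedy_branching[of E "($) w"] by blast
  have "w \<bullet> x \<le> w \<bullet> indegree B" if x: "x \<in> base_polytope (nbhd_rank E)" for x
  proof -
    define d where "d v = indegree B $ v - x $ v" for v
    have sum_d: "(\<Sum>v\<in>A. d v) = real (card (B -` A)) - (\<Sum>v\<in>A. x $ v)" for A
      by (simp add: d_def sum_subtractf sum_indegree)
    have "0 \<le> (\<Sum>v\<in>{v\<in>UNIV. t \<le> w $ v}. d v)" for t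
    proof -
      let ?A = "{v\<in>UNIV. t \<le> w $ v}"
      \<comment> \<open>A node with some \<open>u\<close> of \<open>?A\<close> among its choices is
        sent to weight at least \<open>w $ u\<close>, hence at least \<open>t\<close>.\<close>
      have "closed_nbhd E ?A \<subseteq> B -` ?A"
        using greedy by (fastforce simp: closed_nbhd_def intro: order_trans)
      then have "nbhd_rank E ?A \<le> card (B -` ?A)"
        by (simp add: nbhd_rank_eq_card_closed_nbhd card_mono)
      moreover have "(\<Sum>v\<in>?A. x $ v) \<le> real (nbhd_rank E ?A)"
        using x by (simp add: base_polytope_def polymatroid_polytope_def)
      ultimately show ?thesis
        unfolding sum_d by linarith
    qed
    \<comment> \<open>Any lower bound of \<open>w\<close> serves here: the total of \<open>d\<close>
      vanishes, both vectors having coordinate sum \<open>CARD('v)\<close>.\<close>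
    then have "Min (range (($) w)) * (\<Sum>v\<in>UNIV. d v) \<le> (\<Sum>v\<in>UNIV. w $ v * d v)"
      by (intro Abel_inequality) auto
    moreover have "(\<Sum>v\<in>UNIV. d v) = 0"
      using x by (simp add: sum_d base_polytope_def nbhd_rank_UNIV)
    ultimately show ?thesis
      by (simp add: inner_vec_def d_def right_diff_distrib sum_subtractf)
  qed
  with B that show thesis
    by blast
qed

theorem proposition7p3:
  fixes E :: "'v::finite set set"
  assumes "simple_graph E"
  shows "polymatroid (nbhd_rank E) \<and>
         (\<lambda>x. x + ones) ` neighbotope E = base_polytope (nbhd_rank E)"
proof
  show "polymatroid (nbhd_rank E)"
    by (rule polymatroid_nbhd_rank)
  let ?I = "{indegree B | B. branching E B}"
  have "convex hull ?I \<subseteq> base_polytope (nbhd_rank E)"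
    by (intro hull_minimal convex_base_polytope) (auto intro: indegree_in_base_polytope)
  moreover have "x \<in> convex hull ?I" if x: "x \<in> base_polytope (nbhd_rank E)" for x
  proof (rule ccontr)
    assume "x \<notin> convex hull ?I"
    moreover have "closed (convex hull ?I)"
      by (intro compact_imp_closed finite_imp_compact_convex_hull) simp
    ultimately obtain a b where ab: "a \<bullet> x < b" "\<And>y. y \<in> convex hull ?I \<Longrightarrow> b < a \<bullet> y"
      using separating_hyperplane_closed_point[of "convex hull ?I" x] by auto
    \<comment> \<open>The hyperplane puts \<open>x\<close> on its lower side, so the functional to
      maximise is \<open>- a\<close>.\<close>
    obtain B where "branching E B" and "(- a) \<bullet> x \<le> (- a) \<bullet> indegree B"
      using base_polytope_linear_bound[of E "- a"] x by metis
    moreover from \<open>branching E B\<close> have "b < a \<bullet> indegree B"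
      by (intro ab(2) hull_inc) blast
    ultimately show False
      using ab(1) by simp
  qed
  ultimately show "(\<lambda>x. x + ones) ` neighbotope E = base_polytope (nbhd_rank E)"
    unfolding neighbotope_translate by blast
qed

end
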